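(* Let $m,d,k$ be integers such that $m\ge 4$, $m\equiv 0\pmod 4$, $d\in\{m/4,\,3m/4\}$, and $k\ge 3$ if $d<m/2$, while $k\ge 4$ if $d>m/2$. Define $$B=[0,m-1]\setminus\{d\},\quad L=\{m-d,2m-d,\ldots,km-d\},\quad a^*=(k+1)m-2d,$$ $$A^*=B\cup L\cup(a^*-B),\qquad A=A^*\cup\{m\}.$$ Then $A_1:=A\cup\{-d,(k+1)m-d\}$ is MSTD. For $r\ge 1$ define recursively $$A_{2r}:=A_{2r-1}\cup\{(k+r+1)m-d\},\qquad A_{2r+1}:=A_{2r-1}\cup\{-rm-d,\,(k+r+1)m-d\}.$$ Then for every $r\ge1$ the set $A_{2r}$ is MDTS and the set $A_{2r+1}$ is MSTD, and $A_1\subset\cdots\subset A_{2r-1}\subset A_{2r}\subset A_{2r+1}\subset\cdots$ is a non-filling-in alternating sequence. Additionally, writing $A_i^*=A_i\setminus\{m\}$, for every $r\ge1$ we have: (1) $m-A_{2r-1}^*\subseteq A_{2r-1}^*-A_{2r-1}^*$; (2) $m+A_{2r-1}^*\subseteq A_{2r-1}^*+A_{2r-1}^*$; (3) $|A_{2r+1}+A_{2r+1}|=|A_{2r+1}-A_{2r+1}|+1$; (4) $|A_{2r}+A_{2r}|\le|A_{2r}-A_{2r}|-m+3$.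
   Context: For integers $a\le b$, $[a,b]$ denotes the set of integers $z$ with $a\le z\le b$. For a finite set of integers $A$ and an integer $c$: $A+A=\{a+b:a,b\in A\}$, $A-A=\{a-b:a,b\in A\}$, $c+A=\{c+a:a\in A\}$, $c-A=\{c-a:a\in A\}$; $|\cdot|$ denotes cardinality. $A$ is MSTD (More Sums Than Differences) if $|A+A|>|A-A|$, and MDTS (More Differences Than Sums) if $|A-A|>|A+A|$. A non-filling-in alternating sequence is an infinite sequence $A_1,A_2,A_3,\dots$ of finite sets of integers such that each $A_i$ is properly contained in $A_{i+1}$, the sets are alternately MSTD and MDTS (here $A_i$ is MSTD for odd $i$ and MDTS for even $i$), and no filling in occurs: for every $j$, if an integer $z$ with $\min A_j\le z\le\max A_j$ is not in $A_j$, then $z\notin A_i$ for all $i>j$. *)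

theory Defs
  imports Main "HOL-Library.Set_Algebras"
begin

text \<open>
  The sumset \<open>A + A\<close> and the translate \<open>c +o A\<close> are those of
  \<open>HOL-Library.Set_Algebras\<close>. On sets, the symbol \<open>-\<close> is always
  set-theoretic difference; the arithmetic difference set is \<open>diffset\<close>, and the
  reflection \<open>c - A\<close> is the image \<open>(-) c ` A\<close>.
\<close>

definition diffset :: "int set \<Rightarrow> int set \<Rightarrow> int set" where
  "diffset A B = {a - b |a b. a \<in> A \<and> b \<in> B}"

definition MSTD :: "int set \<Rightarrow> bool" where
  "MSTD A \<longleftrightarrow> finite A \<and> card (A + A) > card (diffset A A)"

definition MDTS :: "int set \<Rightarrow> bool" where
  "MDTS A \<longleftrightarrow> finite A \<and> card (diffset A A) > card (A + A)"

text \<open>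
  Sequences are indexed from 1; the value at index 0 is irrelevant.
  \<open>Min\<close> is only ever applied to nonempty sets here, since neither an MSTD set
  nor an MDTS set can be empty.
\<close>

definition non_filling_in_alternating :: "(nat \<Rightarrow> int set) \<Rightarrow> bool" where
  "non_filling_in_alternating S \<longleftrightarrow>
     (\<forall>i\<ge>1. finite (S i)) \<and>
     (\<forall>i\<ge>1. S i \<subset> S (Suc i)) \<and>
     (\<forall>i\<ge>1. odd i \<longrightarrow> MSTD (S i)) \<and>
     (\<forall>i\<ge>1. even i \<longrightarrow> MDTS (S i)) \<and>
     (\<forall>j\<ge>1. \<forall>z. Min (S j) \<le> z \<and> z \<le> Max (S j) \<and> z \<notin> S j \<longrightarrow> (\<forall>i>j. z \<notin> S i))"

definition set_B :: "int \<Rightarrow> int \<Rightarrow> int set" where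
  "set_B m d = {0..m - 1} - {d}"

definition set_L :: "int \<Rightarrow> int \<Rightarrow> int \<Rightarrow> int set" where
  "set_L m d k = {j * m - d |j. 1 \<le> j \<and> j \<le> k}"

definition a_star :: "int \<Rightarrow> int \<Rightarrow> int \<Rightarrow> int" where
  "a_star m d k = (k + 1) * m - 2 * d"

definition set_A_star :: "int \<Rightarrow> int \<Rightarrow> int \<Rightarrow> int set" where
  "set_A_star m d k = set_B m d \<union> set_L m d k \<union> (-) (a_star m d k) ` set_B m d"

definition set_A :: "int \<Rightarrow> int \<Rightarrow> int \<Rightarrow> int set" where
  "set_A m d k = set_A_star m d k \<union> {m}"

text \<open>
  In the last clause the index is \<open>2r\<close> (for even \<open>n\<close>) or \<open>2r + 1\<close> (for odd \<open>n\<close>).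
\<close>

fun A_seq :: "int \<Rightarrow> int \<Rightarrow> int \<Rightarrow> nat \<Rightarrow> int set" where
  "A_seq m d k 0 = {}"
| "A_seq m d k (Suc 0) = set_A m d k \<union> {- d, (k + 1) * m - d}"
| "A_seq m d k (Suc (Suc n)) =
     (let r = int (Suc (Suc n) div 2) in
      if even n then A_seq m d k (Suc n) \<union> {(k + r + 1) * m - d}
      else A_seq m d k n \<union> {- r * m - d, (k + r + 1) * m - d})"

lemma A_seq_1: "A_seq m d k 1 = set_A m d k \<union> {- d, (k + 1) * m - d}"
  by simp

lemma A_seq_even:
  assumes "r \<ge> 1"
  shows "A_seq m d k (2 * r) = A_seq m d k (2 * r - 1) \<union> {(k + int r + 1) * m - d}"
proof -
  obtain s where "r = Suc s"
    using assms by (cases r) auto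
  then show ?thesis
    by (simp add: Let_def)
qed

lemma A_seq_odd:
  assumes "r \<ge> 1"
  shows "A_seq m d k (2 * r + 1) =
    A_seq m d k (2 * r - 1) \<union> {- int r * m - d, (k + int r + 1) * m - d}"
proof -
  obtain s where "r = Suc s"
    using assms by (cases r) auto
  then show ?thesis
    by (simp add: Let_def algebra_simps)
qed

definition A_seq_star :: "int \<Rightarrow> int \<Rightarrow> int \<Rightarrow> nat \<Rightarrow> int set" where
  "A_seq_star m d k i = A_seq m d k i - {m}"

end

theory Submission
  imports Defs
begin

text \<open>
  Write \<open>x\<^sub>j = j m - d\<close> for the rungs of an arithmetic progression of common difference \<open>m\<close>. Each
  set of odd index is \<open>S \<union> {m}\<close> with \<open>S = B \<union> {x\<^sub>j. - s \<le> j \<le> k + 1 + s} \<union> (a\<^sup>* - B)\<close>, and each set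
  of even index adds the single rung \<open>x = x\<^sub>j\<close> with \<open>j = k + 2 + s\<close> to it.

  The set \<open>S\<close> is symmetric, \<open>S = a\<^sup>* - S\<close>, hence \<open>S - S = (S + S) - a\<^sup>*\<close> and \<open>S\<close> has as many sums as
  differences. Adjoining \<open>m\<close> gives no new sum \<open>m + s\<close> (lemma \<open>m_plus_ladder\<close>), hence by symmetry no
  new difference, but it does give the sum \<open>2 m\<close> (lemma \<open>double_m_notin_sums\<close>). The last point is the
  reason for the gap at \<open>d\<close> in \<open>B\<close>. Sums without a rung miss \<open>2 m\<close> because of their size. Modulo \<open>m\<close>,
  a rung is \<open>- d\<close>, and \<open>2 m\<close> minus a rung is \<open>d\<close>, the residue missing from \<open>B\<close>; the condition
  \<open>d = m/4\<close> or \<open>d = 3m/4\<close> says \<open>4 d = 0\<close> but \<open>2 d \<noteq> 0\<close> modulo \<open>m\<close>, so that the same gap excludes a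
  second summand from \<open>a\<^sup>* - B\<close> and two rungs do not add up to \<open>2 m\<close>. So a set of odd index has
  exactly one sum more than differences.

  Adjoining \<open>x\<close> destroys the symmetry. Let \<open>N\<close> be the number of elements of \<open>x + S\<close> outside \<open>S + S\<close>.
  At most \<open>N + 2\<close> sums arise that are not in \<open>S + S\<close>, the two extra ones being \<open>2 m\<close> and \<open>2 x\<close>,
  whereas by symmetry \<open>x - S\<close> contributes \<open>N\<close> new positive differences and their negatives are
  new as well. So differences exceed sums by at least \<open>N - 2\<close>, and \<open>N \<ge> m - 1\<close> since the top rung
  together with all but one of the elements of \<open>a\<^sup>* - B\<close> lead to new sums
  (lemma \<open>card_new_sums_ge\<close>).

  No filling in occurs because each step only adds rungs outside the range covered so far.
\<close>

section \<open>Symmetric sets with one or two adjoined elements\<close>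

lemma diffset_finite: "finite A \<Longrightarrow> finite B \<Longrightarrow> finite (diffset A B)"
proof -
  assume "finite A" "finite B"
  moreover have "diffset A B = (\<lambda>(a, b). a - b) ` (A \<times> B)"
    by (auto simp: diffset_def)
  ultimately show ?thesis by simp
qed

lemma diffset_uminus: "z \<in> diffset S S \<Longrightarrow> - z \<in> diffset S S"
proof -
  assume "z \<in> diffset S S"
  then obtain a b where "a \<in> S" "b \<in> S" "- z = b - a"
    by (auto simp: diffset_def)
  then show ?thesis unfolding diffset_def by blast
qed

lemma diffset_symmetric_eq:
  assumes "(-) c ` S = S"
  shows "diffset S S = (\<lambda>z. z - c) ` (S + S)"
proof -
  have refl: "c - s \<in> S" if "s \<in> S" for s
    using assms that by blast
  show ?thesis
  proof (intro equalityI subsetI)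
    fix z assume "z \<in> diffset S S"
    then obtain a b where "a \<in> S" "b \<in> S" "z = a - b"
      by (auto simp: diffset_def)
    then have "a + (c - b) \<in> S + S" "z = a + (c - b) - c"
      using refl by (auto intro: set_plus_intro)
    then show "z \<in> (\<lambda>z. z - c) ` (S + S)" by blast
  next
    fix z assume "z \<in> (\<lambda>z. z - c) ` (S + S)"
    then obtain a b where "a \<in> S" "b \<in> S" "z = a - (c - b)"
      by (auto simp: set_plus_def)
    then show "z \<in> diffset S S"
      using refl by (auto simp: diffset_def)
  qed
qed

lemma card_diffset_symmetric:
  assumes "(-) c ` S = S"
  shows "card (diffset S S) = card (S + S)"
  unfolding diffset_symmetric_eq[OF assms] by (rule card_image) (simp add: inj_on_def)

lemma reflected_subset_diffset:
  assumes sym: "(-) c ` S = S" and plus: "y +o S \<subseteq> S + S"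
  shows "(-) y ` S \<subseteq> diffset S S"
proof
  fix z assume "z \<in> (-) y ` S"
  then obtain s where s: "s \<in> S" "z = y - s" by auto
  have "c - s \<in> S" using sym s by blast
  then have "y + (c - s) \<in> S + S"
    using plus by (auto simp: elt_set_plus_def)
  then have "y + (c - s) - c \<in> (\<lambda>z. z - c) ` (S + S)" by blast
  then show "z \<in> diffset S S"
    using s by (simp add: diffset_symmetric_eq[OF sym])
qed

text \<open>
  Since \<open>y + S\<close> is absorbed by \<open>S + S\<close>, symmetry lets \<open>S - S\<close> absorb \<open>y - S\<close> too, and only \<open>2 y\<close>
  can be new.
\<close>

lemma card_sums_insert_eq_Suc:
  fixes S :: "int set"
  assumes fin: "finite S" and ne: "S \<noteq> {}"
    and sym: "(-) c ` S = S"
    and plus: "y +o S \<subseteq> S + S"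
    and new: "2 * y \<notin> S + S"
  shows "card (insert y S + insert y S) = card (diffset (insert y S) (insert y S)) + 1"
proof -
  have "y + s \<in> S + S" if "s \<in> S" for s
    using plus that by (auto simp: elt_set_plus_def)
  then have sums: "insert y S + insert y S = insert (2 * y) (S + S)"
    by (auto simp: set_plus_def add.commute)
  have neg: "y - s \<in> diffset S S" if "s \<in> S" for s
    using reflected_subset_diffset[OF sym plus] that by blast
  then have pos: "s - y \<in> diffset S S" if "s \<in> S" for s
    using diffset_uminus[OF neg[OF that]] by simp
  have "0 \<in> diffset S S"
    using ne by (force simp: diffset_def)
  then have "diffset (insert y S) (insert y S) = diffset S S"
    using neg pos unfolding diffset_def by auto
  then show ?thesis
    using fin new by (simp add: sums finite_set_plus card_diffset_symmetric[OF sym])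
qed

text \<open>
  A new element \<open>x\<close> above \<open>S\<close> counts once on the side of sums but twice on the side of differences,
  as \<open>x - s\<close> and \<open>s - x\<close>. The summand \<open>2\<close> accounts for \<open>2 y\<close> and \<open>2 x\<close>.
\<close>

lemma card_sums_insert_above_le:
  fixes S :: "int set"
  assumes fin: "finite S"
    and sym: "(-) c ` S = S"
    and plus: "y +o S \<subseteq> S + S"
    and xy: "x + y \<in> S + S"
    and above: "\<And>s. s \<in> S \<Longrightarrow> s < x"
  shows "card (insert x (insert y S) + insert x (insert y S)) + card (x +o S - (S + S))
    \<le> card (diffset (insert x (insert y S)) (insert x (insert y S))) + 2"
proof -
  let ?T = "insert x (insert y S)"
  define P where "P = x +o S - (S + S)"
  define Q where "Q = (\<lambda>z. z - c) ` P"
  have finS: "finite (S + S)" and finP: "finite P" and finD: "finite (diffset S S)"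
    using fin by (auto simp: P_def finite_set_plus elt_set_plus_def Setcompr_eq_image diffset_finite)
  have ys: "y + s \<in> S + S" if "s \<in> S" for s
    using plus that by (auto simp: elt_set_plus_def)
  have xs: "x + s \<in> (S + S) \<union> P" if "s \<in> S" for s
    using that by (auto simp: P_def elt_set_plus_def)
  have ss: "s + t \<in> S + S" if "s \<in> S" "t \<in> S" for s t
    using that by (rule set_plus_intro)
  have "?T + ?T \<subseteq> (S + S) \<union> P \<union> {2 * x, 2 * y}"
  proof
    fix z assume "z \<in> ?T + ?T"
    then obtain u v where "u \<in> ?T" "v \<in> ?T" "z = u + v"
      by (rule set_plus_elim)
    then show "z \<in> (S + S) \<union> P \<union> {2 * x, 2 * y}"
      using ys[of u] ys[of v] xs[of u] xs[of v] ss[of u v] xy by (auto simp: add.commute)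
  qed
  then have "card (?T + ?T) \<le> card ((S + S) \<union> P \<union> {2 * x, 2 * y})"
    using finS finP by (intro card_mono) auto
  also have "\<dots> \<le> card (S + S) + card P + card {2 * x, 2 * y}"
    by (meson add_le_mono card_Un_le le_refl order_trans)
  also have "\<dots> \<le> card (S + S) + card P + 2"
    by (simp add: card_insert_if)
  finally have sums: "card (?T + ?T) \<le> card (S + S) + card P + 2" .

  have cS: "c - s \<in> S" if "s \<in> S" for s
    using sym that by blast
  have Q_form: "\<exists>s\<in>S. q = x - s" if "q \<in> Q" for q
  proof -
    from that obtain s where "s \<in> S" "q = x + s - c"
      by (auto simp: Q_def P_def elt_set_plus_def)
    then show ?thesis
      by (intro bexI[of _ "c - s"]) (auto simp: cS)
  qed
  have Q_pos: "q > 0" if "q \<in> Q" for q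
    using Q_form[OF that] above by force
  have Q_new: "q \<notin> diffset S S" if "q \<in> Q" for q
    using that by (auto simp: Q_def P_def diffset_symmetric_eq[OF sym])
  have neg_new: "- q \<notin> diffset S S" if "q \<in> Q" for q
    using Q_new[OF that] diffset_uminus[of "- q" S] by auto
  have finQ: "finite Q" using finP by (simp add: Q_def)
  have "- q \<notin> Q" if "q \<in> Q" for q
    using Q_pos[OF that] Q_pos[of "- q"] by auto
  then have disj1: "Q \<inter> uminus ` Q = {}" by auto
  have disj2: "diffset S S \<inter> (Q \<union> uminus ` Q) = {}" using Q_new neg_new by blast
  have "diffset S S \<union> (Q \<union> uminus ` Q) \<subseteq> diffset ?T ?T"
    using Q_form by (fastforce simp: diffset_def)
  then have "card (diffset S S \<union> (Q \<union> uminus ` Q)) \<le> card (diffset ?T ?T)"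
    using fin by (intro card_mono diffset_finite) auto
  moreover have "card (diffset S S \<union> (Q \<union> uminus ` Q)) = card (diffset S S) + (card Q + card Q)"
    using finQ finD disj1 disj2 by (simp add: card_Un_disjoint card_image)
  moreover have "card Q = card P"
    unfolding Q_def by (rule card_image) (simp add: inj_on_def)
  ultimately show ?thesis
    using sums unfolding P_def by (simp add: card_diffset_symmetric[OF sym])
qed

section \<open>The ladder sets\<close>

definition rungs :: "int \<Rightarrow> int \<Rightarrow> int \<Rightarrow> int \<Rightarrow> int set" where
  "rungs m d p q = (\<lambda>j. j * m - d) ` {p..q}"

definition ladder :: "int \<Rightarrow> int \<Rightarrow> int \<Rightarrow> int \<Rightarrow> int \<Rightarrow> int set" where
  "ladder m d k p q = set_B m d \<union> (-) (a_star m d k) ` set_B m d \<union> rungs m d p q"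

lemma B_iff: "b \<in> set_B m d \<longleftrightarrow> 0 \<le> b \<and> b < m \<and> b \<noteq> d"
  by (auto simp: set_B_def)

text \<open>
  Both lower bounds on \<open>k\<close> say that \<open>2 m \<le> k m - 2 d\<close>, which puts \<open>a\<^sup>* - B\<close> far enough above \<open>B\<close>.
  Naming the quarter \<open>e\<close> of \<open>m\<close> makes the conditions on \<open>d\<close> linear.
\<close>

locale ladder_parameters =
  fixes e m d k :: int
  assumes e_pos: "e \<ge> 1"
    and m_eq: "m = 4 * e"
    and d_eq: "d = e \<or> d = 3 * e"
    and km_ge: "2 * m \<le> k * m - 2 * d"
begin

abbreviation S :: "int \<Rightarrow> int set" where
  "S s \<equiv> ladder m d k (- s) (k + 1 + s)"

lemma m_pos: "m > 0" and d_pos: "d > 0" and d_less: "d < m"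
  using e_pos m_eq d_eq by auto

lemma multiple_less: "p < q \<Longrightarrow> p * m + m \<le> q * m"
proof -
  assume "p < q"
  then have "(p + 1) * m \<le> q * m"
    using m_pos by (intro mult_right_mono) auto
  then show ?thesis by (simp add: algebra_simps)
qed

lemma multiple_le: "p \<le> q \<Longrightarrow> p * m \<le> q * m"
  using m_pos by (intro mult_right_mono) auto

lemma k_ge: "k \<ge> 3"
  using multiple_le[of k 2] km_ge d_pos by linarith

lemma small_multiple_eq:
  assumes "p * m = q * m + t" "- m < t" "t < m"
  shows "p = q"
proof (rule ccontr)
  assume "p \<noteq> q"
  then consider "p < q" | "q < p" by linarith
  then show False
    using assms multiple_less[of p q] multiple_less[of q p] by cases linarith+
qed

lemma ladder_cases [consumes 1, case_names low high rung]:
  assumes "z \<in> ladder m d k p q"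
  obtains "z \<in> set_B m d" | b where "b \<in> set_B m d" "z = a_star m d k - b"
    | j where "p \<le> j" "j \<le> q" "z = j * m - d"
  using assms by (auto simp: ladder_def rungs_def)

lemma low_in_ladder: "b \<in> set_B m d \<Longrightarrow> b \<in> ladder m d k p q"
  and high_in_ladder: "b \<in> set_B m d \<Longrightarrow> a_star m d k - b \<in> ladder m d k p q"
  and rung_in_ladder: "p \<le> j \<Longrightarrow> j \<le> q \<Longrightarrow> j * m - d \<in> ladder m d k p q"
  by (auto simp: ladder_def rungs_def)

text \<open>Modulo \<open>m\<close> this says that \<open>2 d\<close> is \<open>m/2\<close>.\<close>

lemma twice_d:
  obtains t where "t = 1 \<or> t = 2" "t * m = 2 * d + 2 * e"
proof -
  obtain t :: int where "d = e \<and> t = 1 \<or> d = 3 * e \<and> t = 2"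
    using d_eq by blast
  then show thesis using that[of t] m_eq by auto
qed

lemma half_in_B: "2 * e \<in> set_B m d"
  unfolding B_iff using e_pos m_eq d_eq by auto

lemma a_star_eq: "a_star m d k = k * m + m - 2 * d"
  by (simp add: a_star_def algebra_simps)

lemma finite_ladder: "finite (ladder m d k p q)"
  by (simp add: ladder_def rungs_def set_B_def)

lemma reflect_ladder: "(-) (a_star m d k) ` S s = S s"
proof -
  have incl: "a_star m d k - z \<in> S s" if "z \<in> S s" for z
    using that
  proof (cases rule: ladder_cases)
    case low
    then show ?thesis by (rule high_in_ladder)
  next
    case (high b)
    then show ?thesis by (simp add: low_in_ladder)
  next
    case (rung j)
    then have "(k + 1 - j) * m - d \<in> S s"
      by (intro rung_in_ladder) auto
    moreover have "(k + 1 - j) * m - d = a_star m d k - z"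
      using rung(3) by (simp add: a_star_eq algebra_simps)
    ultimately show ?thesis by simp
  qed
  show ?thesis
  proof (intro equalityI subsetI)
    fix z assume "z \<in> S s"
    then have "z = a_star m d k - (a_star m d k - z)" "a_star m d k - z \<in> S s"
      using incl by auto
    then show "z \<in> (-) (a_star m d k) ` S s" by blast
  qed (use incl in auto)
qed

lemma ladder_lower:
  assumes "z \<in> ladder m d k p q" "p \<le> 0"
  shows "p * m - d \<le> z"
  using assms(1)
proof (cases rule: ladder_cases)
  case (rung j)
  then show ?thesis using multiple_le[of p j] by simp
qed (use multiple_le[of p 0] assms d_pos d_less km_ge in \<open>auto simp: B_iff a_star_eq\<close>)

lemma ladder_upper:
  assumes "z \<in> ladder m d k p q" "k + 1 \<le> q"
  shows "z \<le> q * m - d"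
  using assms(1)
proof (cases rule: ladder_cases)
  case (rung j)
  then show ?thesis using multiple_le[of j q] by simp
qed (use multiple_le[of "k + 1" q] assms d_pos d_less km_ge in
    \<open>auto simp: B_iff a_star_eq algebra_simps\<close>)

lemma m_notin_ladder: "m \<notin> ladder m d k p q"
proof
  assume "m \<in> ladder m d k p q"
  then show False
  proof (cases rule: ladder_cases)
    case (rung j)
    then have eq: "j * m = 1 * m + d" by simp
    then have "j = 1"
      using d_pos d_less by (intro small_multiple_eq[OF eq]) auto
    then show False using eq d_pos by simp
  next
    case (high b)
    then show False using km_ge d_pos by (auto simp: B_iff a_star_eq)
  qed (simp add: B_iff)
qed

section \<open>Sums with the element \<open>m\<close>\<close>

text \<open>
  Adding a rung to an element of \<open>B\<close> reaches everything whose residue is not \<open>0\<close>, because \<open>d\<close> is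
  the only residue missing from \<open>B\<close>. This leaves \<open>m + 0\<close> and \<open>m + (a\<^sup>* - m/2)\<close>, whose residue is \<open>0\<close>,
  and \<open>m\<close> plus the top rung, which lies one rung too high; these are reached through \<open>m/2 \<in> B\<close>.
\<close>

lemma m_plus_ladder:
  assumes s: "s \<ge> 0"
  shows "m +o S s \<subseteq> S s + S s"
proof
  let ?h = "2 * e"
  have zero: "0 \<in> set_B m d"
    using m_pos d_pos by (simp add: B_iff)
  have rung_low: "j * m - d + b \<in> S s + S s" if "- s \<le> j" "j \<le> k + 1 + s" "b \<in> set_B m d" for j b
    using that by (intro set_plus_intro rung_in_ladder low_in_ladder)
  have rung_high: "j * m - d + (a_star m d k - b) \<in> S s + S s"
    if "- s \<le> j" "j \<le> k + 1 + s" "b \<in> set_B m d" for j b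
    using that by (intro set_plus_intro rung_in_ladder high_in_ladder)
  fix w assume "w \<in> m +o S s"
  then obtain z where z: "z \<in> S s" "w = m + z"
    by (auto simp: elt_set_plus_def)
  from z(1) have "m + z \<in> S s + S s"
  proof (cases rule: ladder_cases)
    case low
    then have b: "0 \<le> z" "z < m" by (auto simp: B_iff)
    consider "z = 0" | "z + d < m" "z \<noteq> 0" | "z + d \<ge> m" by linarith
    then show ?thesis
    proof cases
      case 1
      have "?h + ?h \<in> S s + S s"
        by (intro set_plus_intro low_in_ladder half_in_B)
      then show ?thesis using 1 m_eq by simp
    next
      case 2
      have "1 * m - d + (z + d) \<in> S s + S s"
        using 2 b s k_ge d_pos by (intro rung_low) (auto simp: B_iff)
      then show ?thesis by simp
    next
      case 3
      have "2 * m - d + (z + d - m) \<in> S s + S s"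
        using 3 b s k_ge d_less by (intro rung_low) (auto simp: B_iff)
      then show ?thesis by simp
    qed
  next
    case (high b)
    then have b: "0 \<le> b" "b < m" "b \<noteq> d" by (auto simp: B_iff)
    consider "b = ?h" | "b \<noteq> ?h" "d + b \<le> m" | "b \<noteq> ?h" "d + b > m" by linarith
    then show ?thesis
    proof cases
      case 1
      have "(a_star m d k - 0) + ?h \<in> S s + S s"
        using zero by (intro set_plus_intro low_in_ladder high_in_ladder half_in_B)
      moreover have "(a_star m d k - 0) + ?h = m + z" using 1 high m_eq by simp
      ultimately show ?thesis by (simp only:)
    next
      case 2
      have "(k + 1) * m - d + (m - d - b) \<in> S s + S s"
        using 2 b s k_ge d_pos d_eq m_eq by (intro rung_low) (auto simp: B_iff)
      moreover have "(k + 1) * m - d + (m - d - b) = m + z"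
        using high(2) by (simp add: a_star_eq algebra_simps)
      ultimately show ?thesis by (simp only:)
    next
      case 3
      have "k * m - d + (2 * m - d - b) \<in> S s + S s"
        using 3 b s k_ge d_less d_eq m_eq by (intro rung_low) (auto simp: B_iff)
      moreover have "k * m - d + (2 * m - d - b) = m + z"
        using high(2) by (simp add: a_star_eq algebra_simps)
      ultimately show ?thesis by (simp only:)
    qed
  next
    case (rung j)
    show ?thesis
    proof (cases "j \<le> k + s")
      case True
      have "(j + 1) * m - d + 0 \<in> S s + S s"
        using True rung zero by (intro rung_low) auto
      moreover have "(j + 1) * m - d + 0 = m + z"
        using rung(3) by (simp add: algebra_simps)
      ultimately show ?thesis by (simp only:)
    next
      case False
      then have j: "j = k + 1 + s" using rung by simp
      \<comment> \<open>\<open>m + x\<^sub>j = x\<^sub>i + (a\<^sup>* - m/2)\<close> where \<open>(i - s - 1) m = 2 d + m/2\<close>\<close>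
      obtain t where t: "t = 1 \<or> t = 2" "t * m = 2 * d + ?h"
        by (rule twice_d)
      have "(s + 1 + t) * m - d + (a_star m d k - ?h) \<in> S s + S s"
        using s k_ge t(1) by (intro rung_high half_in_B) auto
      moreover have "(s + 1 + t) * m - d + (a_star m d k - ?h) = m + z"
        using rung(3) j t(2) by (simp add: a_star_eq algebra_simps)
      ultimately show ?thesis by simp
    qed
  qed
  then show "w \<in> S s + S s" using z by simp
qed

lemma set_plus_ladder_cases [consumes 1, case_names core_core rung_low rung_high rung_rung]:
  assumes "w \<in> ladder m d k p q + ladder m d k p q"
  obtains u v where "u \<in> set_B m d \<union> (-) (a_star m d k) ` set_B m d"
      "v \<in> set_B m d \<union> (-) (a_star m d k) ` set_B m d" "w = u + v"
    | j b where "p \<le> j" "j \<le> q" "b \<in> set_B m d" "w = j * m - d + b"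
    | j b where "p \<le> j" "j \<le> q" "b \<in> set_B m d" "w = j * m - d + (a_star m d k - b)"
    | i j where "p \<le> i" "i \<le> q" "p \<le> j" "j \<le> q" "w = i * m - d + (j * m - d)"
proof -
  from assms obtain u v where "u \<in> ladder m d k p q" "v \<in> ladder m d k p q" "w = u + v"
    by (auto simp: set_plus_def)
  then show thesis
    unfolding ladder_def rungs_def using that by (auto simp: add.commute)
qed

lemma double_m_notin_sums: "2 * m \<notin> ladder m d k p q + ladder m d k p q"
proof
  assume "2 * m \<in> ladder m d k p q + ladder m d k p q"
  then show False
  proof (cases rule: set_plus_ladder_cases)
    case (core_core u v)
    then show False using km_ge d_less by (auto simp: B_iff a_star_eq)
  next
    case (rung_low j b)
    then have eq: "j * m = 2 * m + (d - b)" by simp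
    then have "j = 2"
      using rung_low d_pos d_less by (intro small_multiple_eq[OF eq]) (auto simp: B_iff)
    with eq have "2 * m = 2 * m + (d - b)" by (simp only:)
    then show False using rung_low(3) by (simp add: B_iff)
  next
    case (rung_high j b)
    \<comment> \<open>\<open>- 3 d\<close> is congruent to \<open>d\<close> modulo \<open>m\<close>\<close>
    obtain t where "t * m = 2 * d + 2 * e" by (rule twice_d)
    with m_eq have "2 * (t * m) = 4 * d + m" by simp
    moreover have "(j + k - 2 * t) * m = j * m + k * m - 2 * (t * m)"
      by (simp add: algebra_simps)
    ultimately have eq: "(j + k - 2 * t) * m = 0 * m + (b - d)"
      using rung_high(4) a_star_eq by linarith
    have "j + k - 2 * t = 0"
      using rung_high(3) d_pos d_less by (intro small_multiple_eq[OF eq]) (auto simp: B_iff)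
    with eq have "0 * m = 0 * m + (b - d)" by (simp only:)
    then show False using rung_high(3) by (simp add: B_iff)
  next
    case (rung_rung i j)
    obtain t where "t * m = 2 * d + 2 * e" by (rule twice_d)
    with m_eq have "t * m + 2 * e = 2 * d + m" by simp
    moreover have "(i + j - 1 - t) * m = i * m + j * m - m - t * m"
      by (simp add: algebra_simps)
    ultimately have eq: "(i + j - 1 - t) * m = 0 * m + 2 * e"
      using rung_rung(5) by linarith
    have "i + j - 1 - t = 0"
      using e_pos m_eq by (intro small_multiple_eq[OF eq]) auto
    with eq have "0 * m = 0 * m + 2 * e" by (simp only:)
    then show False using e_pos by simp
  qed
qed

section \<open>Sums with a rung above the ladder\<close>

text \<open>
  The sums \<open>x + (a\<^sup>* - b)\<close> are too large to be anything but a sum of a rung with an element of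
  \<open>a\<^sup>* - B\<close>, which residues modulo \<open>m\<close> exclude, or a sum of two rungs, which forces \<open>b = m - d\<close>.
\<close>

lemma new_rung_plus_high_notin_sums:
  assumes s: "s \<ge> 0" and b: "b \<in> set_B m d" "b \<noteq> m - d"
  shows "(k + 2 + s) * m - d + (a_star m d k - b) \<notin> S s + S s"
proof
  have sm: "s * m \<ge> 0" using s m_pos by simp
  assume "(k + 2 + s) * m - d + (a_star m d k - b) \<in> S s + S s"
  then show False
  proof (cases rule: set_plus_ladder_cases)
    case (core_core u v)
    then have "u \<le> a_star m d k" "v \<le> a_star m d k"
      using km_ge d_less by (auto simp: B_iff a_star_eq)
    then show False
      using core_core(3) b sm d_pos by (simp add: B_iff a_star_eq algebra_simps)
  next
    case (rung_low j b')
    then show False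
      using multiple_le[of j "k + 1 + s"] b sm km_ge m_pos by (simp add: B_iff a_star_eq algebra_simps)
  next
    case (rung_high j b')
    then have eq: "j * m = (k + 2 + s) * m + (b' - b)" by simp
    then have "j = k + 2 + s"
      using rung_high b by (intro small_multiple_eq[OF eq]) (auto simp: B_iff)
    then show False using rung_high by simp
  next
    case (rung_rung i j)
    then have eq: "(2 * k + s + 3 - i - j) * m = 1 * m + (b + d - m)"
      by (simp add: a_star_eq algebra_simps)
    have "2 * k + s + 3 - i - j = 1"
      using b d_pos d_less by (intro small_multiple_eq[OF eq]) (auto simp: B_iff)
    with eq have "1 * m = 1 * m + (b + d - m)" by (simp only:)
    with b show False by simp
  qed
qed

lemma new_rung_plus_top_notin_sums:
  assumes s: "s \<ge> 0"
  shows "(k + 2 + s) * m - d + ((k + 1 + s) * m - d) \<notin> S s + S s"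
proof
  assume "(k + 2 + s) * m - d + ((k + 1 + s) * m - d) \<in> S s + S s"
  then obtain u v where "u \<in> S s" "v \<in> S s"
      "(k + 2 + s) * m - d + ((k + 1 + s) * m - d) = u + v"
    by (auto simp: set_plus_def)
  then show False
    using ladder_upper[of u "- s" "k + 1 + s"] ladder_upper[of v "- s" "k + 1 + s"] s m_pos
    by (simp add: algebra_simps)
qed

lemma card_new_sums_ge:
  assumes s: "s \<ge> 0"
  shows "int (card (((k + 2 + s) * m - d) +o S s - (S s + S s))) \<ge> m - 1"
proof -
  let ?x = "(k + 2 + s) * m - d"
  let ?B = "{0..<m} - {d, m - d}"
  let ?F = "(-) (a_star m d k) ` ?B"
  let ?top = "(k + 1 + s) * m - d"
  have "d \<noteq> m - d" "d \<in> {0..<m}" "m - d \<in> {0..<m}"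
    using d_pos d_less d_eq m_eq e_pos by auto
  then have cardB: "int (card ?B) = m - 2"
    using m_pos m_eq e_pos by (subst card_Diff_subset) (auto simp: nat_diff_distrib)
  have "?top > a_star m d k"
    using s m_pos d_pos by (simp add: a_star_eq algebra_simps add_pos_nonneg)
  then have notin: "?top \<notin> ?F" by auto
  have "card ?F = card ?B"
    by (rule card_image) (simp add: inj_on_def)
  then have "int (card (insert ?top ?F)) = m - 1"
    using cardB notin by simp
  moreover have "card ((+) ?x ` insert ?top ?F) = card (insert ?top ?F)"
    by (rule card_image, rule inj_onI) simp
  moreover have "(+) ?x ` insert ?top ?F \<subseteq> ?x +o S s - (S s + S s)"
  proof
    fix w assume "w \<in> (+) ?x ` insert ?top ?F"
    then consider "w = ?x + ?top" | b where "b \<in> ?B" "w = ?x + (a_star m d k - b)" by blast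
    then show "w \<in> ?x +o S s - (S s + S s)"
    proof cases
      case 1
      have "?top \<in> S s" using s k_ge by (intro rung_in_ladder) auto
      then show ?thesis
        using new_rung_plus_top_notin_sums[OF s] unfolding 1 elt_set_plus_def by blast
    next
      case 2
      then have "b \<in> set_B m d" "b \<noteq> m - d" by (auto simp: B_iff)
      then show ?thesis
        using 2 new_rung_plus_high_notin_sums[OF s, of b] high_in_ladder[of b]
        by (auto simp: elt_set_plus_def)
    qed
  qed
  moreover have "finite (?x +o S s - (S s + S s))"
    using finite_ladder by (auto simp: elt_set_plus_def Setcompr_eq_image)
  ultimately show ?thesis
    using card_mono[of "?x +o S s - (S s + S s)" "(+) ?x ` insert ?top ?F"] by linarith
qed

lemma m_plus_new_rung:
  assumes s: "s \<ge> 0"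
  shows "(k + 2 + s) * m - d + m \<in> S s + S s"
proof -
  \<comment> \<open>\<open>x + m = x\<^sub>i + (a\<^sup>* - m/2)\<close> where \<open>(i - s - 2) m = 2 d + m/2\<close>\<close>
  obtain t where t: "t = 1 \<or> t = 2" "t * m = 2 * d + 2 * e"
    by (rule twice_d)
  have "(s + 2 + t) * m - d + (a_star m d k - 2 * e) \<in> S s + S s"
    using s k_ge t by (intro set_plus_intro rung_in_ladder high_in_ladder half_in_B) auto
  moreover have "(s + 2 + t) * m - d + (a_star m d k - 2 * e) = (k + 2 + s) * m - d + m"
    using t(2) by (simp add: a_star_eq algebra_simps)
  ultimately show ?thesis by simp
qed

section \<open>The sequence\<close>

lemma A_seq_odd_eq: "A_seq m d k (2 * n + 1) = insert m (S (int n))"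
proof (induction n)
  case 0
  have "{0..k + 1} = insert 0 (insert (k + 1) {1..k})"
    using k_ge by auto
  then have "rungs m d 0 (k + 1) = insert (- d) (insert ((k + 1) * m - d) (set_L m d k))"
    by (auto simp: rungs_def set_L_def)
  then show ?case
    by (auto simp: ladder_def set_A_def set_A_star_def)
next
  case (Suc n)
  have "{- int (Suc n)..k + 1 + int (Suc n)} =
      insert (- int (Suc n)) (insert (k + int (Suc n) + 1) {- int n..k + 1 + int n})"
    using k_ge by auto
  then have "S (int (Suc n)) =
      S (int n) \<union> {- int (Suc n) * m - d, (k + int (Suc n) + 1) * m - d}"
    unfolding ladder_def rungs_def by (simp del: of_nat_Suc)
  then show ?case
    using A_seq_odd[of "Suc n" m d k] Suc.IH by auto
qed

lemma A_seq_even_eq: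
  "A_seq m d k (2 * n + 2) = insert m (ladder m d k (- int n) (k + 2 + int n))"
  and A_seq_even_eq_insert:
  "A_seq m d k (2 * n + 2) = insert ((k + 2 + int n) * m - d) (insert m (S (int n)))"
proof -
  have "A_seq m d k (2 * n + 2) = A_seq m d k (2 * n + 1) \<union> {(k + 2 + int n) * m - d}"
    using A_seq_even[of "Suc n" m d k] by (simp del: A_seq.simps add: algebra_simps)
  then show *: "A_seq m d k (2 * n + 2) = insert ((k + 2 + int n) * m - d) (insert m (S (int n)))"
    unfolding A_seq_odd_eq by auto
  have "{- int n..k + 2 + int n} = insert (k + 2 + int n) {- int n..k + 1 + int n}"
    using k_ge by auto
  then show "A_seq m d k (2 * n + 2) = insert m (ladder m d k (- int n) (k + 2 + int n))"
    unfolding * ladder_def rungs_def by auto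
qed

lemma A_seq_eq:
  assumes "i \<ge> 1"
  shows "A_seq m d k i = insert m (ladder m d k (- int ((i - 1) div 2)) (k + 1 + int (i div 2)))"
proof (cases "even i")
  case True
  then obtain c where "i = 2 * c" by (rule evenE)
  with assms obtain n where i: "i = 2 * n + 2" by (cases c) auto
  have "(i - 1) div 2 = n" "k + 1 + int (i div 2) = k + 2 + int n" unfolding i by auto
  then show ?thesis using A_seq_even_eq[of n] i by (simp only:)
next
  case False
  then obtain n where "i = 2 * n + 1" by (rule oddE)
  moreover from this have "(i - 1) div 2 = n" "i div 2 = n" by auto
  ultimately show ?thesis using A_seq_odd_eq[of n] by (simp only:)
qed

lemma A_seq_star_odd_eq: "A_seq_star m d k (2 * n + 1) = S (int n)"
  unfolding A_seq_star_def A_seq_odd_eq using m_notin_ladder by simp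

lemma card_sums_odd:
  "card (A_seq m d k (2 * n + 1) + A_seq m d k (2 * n + 1)) =
    card (diffset (A_seq m d k (2 * n + 1)) (A_seq m d k (2 * n + 1))) + 1"
  unfolding A_seq_odd_eq
  using low_in_ladder[of 0] d_pos m_pos
  by (intro card_sums_insert_eq_Suc[OF finite_ladder _ reflect_ladder m_plus_ladder
        double_m_notin_sums]) (auto simp: B_iff)

lemma card_sums_even:
  "int (card (A_seq m d k (2 * n + 2) + A_seq m d k (2 * n + 2))) \<le>
    int (card (diffset (A_seq m d k (2 * n + 2)) (A_seq m d k (2 * n + 2)))) - m + 3"
proof -
  let ?x = "(k + 2 + int n) * m - d"
  have "z < ?x" if "z \<in> S (int n)" for z
    using ladder_upper[OF that] m_pos by (simp add: algebra_simps)
  then have "card (A_seq m d k (2 * n + 2) + A_seq m d k (2 * n + 2)) +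
      card (?x +o S (int n) - (S (int n) + S (int n)))
    \<le> card (diffset (A_seq m d k (2 * n + 2)) (A_seq m d k (2 * n + 2))) + 2"
    unfolding A_seq_even_eq_insert
    by (intro card_sums_insert_above_le[OF finite_ladder reflect_ladder m_plus_ladder])
      (auto intro: m_plus_new_rung)
  then show ?thesis
    using card_new_sums_ge[of "int n"] by linarith
qed

lemma finite_A_seq: "i \<ge> 1 \<Longrightarrow> finite (A_seq m d k i)"
  by (simp add: A_seq_eq finite_ladder)

lemma MSTD_odd: "MSTD (A_seq m d k (2 * n + 1))"
  unfolding MSTD_def card_sums_odd by (simp del: A_seq.simps add: finite_A_seq)

lemma MDTS_even: "MDTS (A_seq m d k (2 * n + 2))"
  unfolding MDTS_def using card_sums_even[of n] finite_A_seq[of "2 * n + 2"] m_eq e_pos by linarith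

lemma A_seq_bounds:
  assumes "i \<ge> 1" "z \<in> A_seq m d k i"
  shows "- int ((i - 1) div 2) * m - d \<le> z" "z \<le> (k + 1 + int (i div 2)) * m - d"
proof -
  have "0 \<le> int ((i - 1) div 2) * m" "0 \<le> int (i div 2) * m"
    using m_pos by simp_all
  moreover have "(k + 1 + int (i div 2)) * m = k * m + m + int (i div 2) * m"
    by (simp add: algebra_simps)
  ultimately have "- int ((i - 1) div 2) * m - d \<le> m" "m \<le> (k + 1 + int (i div 2)) * m - d"
    unfolding mult_minus_left using m_pos d_pos km_ge by linarith+
  moreover have "z = m \<or> z \<in> ladder m d k (- int ((i - 1) div 2)) (k + 1 + int (i div 2))"
    using assms(2) unfolding A_seq_eq[OF assms(1)] by blast
  ultimately show "- int ((i - 1) div 2) * m - d \<le> z" "z \<le> (k + 1 + int (i div 2)) * m - d"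
    by (elim disjE; simp only:; intro ladder_lower ladder_upper; simp)+
qed

lemma A_seq_psubset:
  assumes "i \<ge> 1"
  shows "A_seq m d k i \<subset> A_seq m d k (Suc i)"
proof -
  let ?lo = "\<lambda>i. - int ((i - 1) div 2)" and ?hi = "\<lambda>i. k + 1 + int (i div 2)"
  have mono: "?lo (Suc i) \<le> ?lo i" "?hi i \<le> ?hi (Suc i)"
    by (simp_all add: div_le_mono)
  have eq: "A_seq m d k (Suc i) = insert m (ladder m d k (?lo (Suc i)) (?hi (Suc i)))"
    by (rule A_seq_eq) simp
  have "rungs m d (?lo i) (?hi i) \<subseteq> rungs m d (?lo (Suc i)) (?hi (Suc i))"
    unfolding rungs_def using mono by (intro image_mono) auto
  then have sub: "A_seq m d k i \<subseteq> A_seq m d k (Suc i)"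
    unfolding A_seq_eq[OF assms] eq ladder_def by blast
  have ends: "?lo (Suc i) * m - d \<in> A_seq m d k (Suc i)" "?hi (Suc i) * m - d \<in> A_seq m d k (Suc i)"
    unfolding eq by (rule insertI2, rule rung_in_ladder; use k_ge in simp)+
  have "?lo (Suc i) < ?lo i \<or> ?hi i < ?hi (Suc i)"
    using assms by (cases "even i") (auto elim!: evenE oddE)
  then have "?lo (Suc i) * m - d \<notin> A_seq m d k i \<or> ?hi (Suc i) * m - d \<notin> A_seq m d k i"
  proof
    assume "?lo (Suc i) < ?lo i"
    then show ?thesis
      using A_seq_bounds(1)[OF assms, of "?lo (Suc i) * m - d"]
        multiple_less[of "?lo (Suc i)" "?lo i"] m_pos by linarith
  next
    assume "?hi i < ?hi (Suc i)"
    then show ?thesis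
      using A_seq_bounds(2)[OF assms, of "?hi (Suc i) * m - d"]
        multiple_less[of "?hi i" "?hi (Suc i)"] m_pos by linarith
  qed
  with sub ends show ?thesis by blast
qed

text \<open>
  The end rungs of each set are its minimum and maximum, so an element that it lacks and that
  appears later is a rung beyond one of them.
\<close>

lemma A_seq_no_filling_in:
  assumes "j \<ge> 1" "i > j"
    and z: "Min (A_seq m d k j) \<le> z" "z \<le> Max (A_seq m d k j)" "z \<notin> A_seq m d k j"
  shows "z \<notin> A_seq m d k i"
proof
  let ?p = "- int ((j - 1) div 2)" and ?q = "k + 1 + int (j div 2)"
  have fin: "finite (A_seq m d k j)" and ne: "A_seq m d k j \<noteq> {}"
    using finite_A_seq[OF assms(1)] A_seq_eq[OF assms(1)] by auto
  have range: "?p * m - d \<le> z" "z \<le> ?q * m - d"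
    using A_seq_bounds[OF assms(1) Min_in[OF fin ne]] A_seq_bounds[OF assms(1) Max_in[OF fin ne]] z
    by linarith+
  assume "z \<in> A_seq m d k i"
  then obtain t where t: "z = t * m - d"
    using z(3) assms(1,2) by (auto simp: A_seq_eq ladder_def rungs_def)
  have "?p \<le> t" "t \<le> ?q"
    using multiple_less[of t ?p] multiple_less[of ?q t] range t m_pos by linarith+
  then have "z \<in> A_seq m d k j"
    using t rung_in_ladder assms(1) by (simp add: A_seq_eq)
  with z(3) show False ..
qed

lemma A_seq_alternating: "non_filling_in_alternating (A_seq m d k)"
  unfolding non_filling_in_alternating_def
proof (intro conjI allI impI)
  fix i :: nat
  show "MSTD (A_seq m d k i)" if "odd i"
    using that MSTD_odd by (metis oddE)
  show "MDTS (A_seq m d k i)" if "i \<ge> 1" "even i"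
  proof -
    obtain n where "i = 2 * Suc n"
      using \<open>i \<ge> 1\<close> \<open>even i\<close> by (metis evenE mult_0_right not0_implies_Suc not_one_le_zero)
    then show ?thesis using MDTS_even[of n] by (simp del: A_seq.simps)
  qed
qed (use finite_A_seq A_seq_psubset A_seq_no_filling_in in auto)

end

theorem theorem5:
  fixes m d k :: int
  assumes "m \<ge> 4"
    and "m mod 4 = 0"
    and "4 * d = m \<or> 4 * d = 3 * m"
    and "2 * d < m \<Longrightarrow> k \<ge> 3"
    and "2 * d > m \<Longrightarrow> k \<ge> 4"
  shows "MSTD (A_seq m d k 1)
    \<and> (\<forall>r\<ge>1. MDTS (A_seq m d k (2 * r)) \<and> MSTD (A_seq m d k (2 * r + 1)))
    \<and> non_filling_in_alternating (A_seq m d k)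
    \<and> (\<forall>r\<ge>1.
        (-) m ` A_seq_star m d k (2 * r - 1)
          \<subseteq> diffset (A_seq_star m d k (2 * r - 1)) (A_seq_star m d k (2 * r - 1))
        \<and> m +o A_seq_star m d k (2 * r - 1)
          \<subseteq> A_seq_star m d k (2 * r - 1) + A_seq_star m d k (2 * r - 1)
        \<and> card (A_seq m d k (2 * r + 1) + A_seq m d k (2 * r + 1))
          = card (diffset (A_seq m d k (2 * r + 1)) (A_seq m d k (2 * r + 1))) + 1
        \<and> int (card (A_seq m d k (2 * r) + A_seq m d k (2 * r)))
          \<le> int (card (diffset (A_seq m d k (2 * r)) (A_seq m d k (2 * r)))) - m + 3)"
proof -
  interpret ladder_parameters "m div 4" m d k
  proof
    show "m div 4 \<ge> 1" "m = 4 * (m div 4)" using assms by auto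
    show "d = m div 4 \<or> d = 3 * (m div 4)" using assms by auto
    have "2 * d < m \<and> k \<ge> 3 \<or> 2 * d > m \<and> k \<ge> 4" using assms by auto
    then show "2 * m \<le> k * m - 2 * d"
    proof
      assume *: "2 * d < m \<and> k \<ge> 3"
      then have "3 * m \<le> k * m" using assms(1) by (intro mult_right_mono) auto
      then show ?thesis using * by linarith
    next
      assume *: "2 * d > m \<and> k \<ge> 4"
      then have "4 * m \<le> k * m" using assms(1) by (intro mult_right_mono) auto
      then show ?thesis using assms(1,3) by linarith
    qed
  qed
  have shift: "\<exists>n. r = Suc n" if "r \<ge> 1" for r :: nat
    using that by (cases r) auto
  have odd_index: "2 * Suc n - 1 = 2 * n + 1" and even_index: "2 * Suc n = 2 * n + 2" for n :: nat
    by auto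
  show ?thesis
  proof (intro conjI allI impI)
    show "MSTD (A_seq m d k 1)" using MSTD_odd[of 0] by simp
    show "non_filling_in_alternating (A_seq m d k)" by (rule A_seq_alternating)
  next
    fix r :: nat
    assume "r \<ge> 1"
    then obtain n where r: "r = Suc n" using shift by blast
    show "MDTS (A_seq m d k (2 * r))"
      unfolding r even_index by (rule MDTS_even)
    show "MSTD (A_seq m d k (2 * r + 1))" by (rule MSTD_odd)
    show "m +o A_seq_star m d k (2 * r - 1)
        \<subseteq> A_seq_star m d k (2 * r - 1) + A_seq_star m d k (2 * r - 1)"
      unfolding r odd_index A_seq_star_odd_eq by (rule m_plus_ladder) simp
    then show "(-) m ` A_seq_star m d k (2 * r - 1)
        \<subseteq> diffset (A_seq_star m d k (2 * r - 1)) (A_seq_star m d k (2 * r - 1))"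
      unfolding r odd_index A_seq_star_odd_eq by (rule reflected_subset_diffset[OF reflect_ladder])
    show "card (A_seq m d k (2 * r + 1) + A_seq m d k (2 * r + 1))
        = card (diffset (A_seq m d k (2 * r + 1)) (A_seq m d k (2 * r + 1))) + 1"
      by (rule card_sums_odd)
    show "int (card (A_seq m d k (2 * r) + A_seq m d k (2 * r)))
        \<le> int (card (diffset (A_seq m d k (2 * r)) (A_seq m d k (2 * r)))) - m + 3"
      unfolding r even_index by (rule card_sums_even)
  qed
qed

end
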